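(* For every integer $n\geq 0$, the number of alternating permutations of length $n$ that avoid the pattern $1\mbox{-}3\mbox{-}2$ equals $C_{\lfloor n/2\rfloor}$. Moreover, for every $n\geq 3$: (1) the number of up-down permutations of length $n$ avoiding $1\mbox{-}3\mbox{-}2$ is $C_{(n-1)/2}$; (2) the number of up-up permutations of length $n$ avoiding $1\mbox{-}3\mbox{-}2$ is $C_{n/2}$; (3) the number of down-up permutations of length $n$ avoiding $1\mbox{-}3\mbox{-}2$ is $C_{(n+1)/2}$; (4) the number of down-down permutations of length $n$ avoiding $1\mbox{-}3\mbox{-}2$ is $C_{n/2}$. Here $C_m=\frac{1}{m+1}\binom{2m}{m}$ is the $m$th Catalan number, and $C_m$ is taken to be $0$ whenever $m$ is not an integer.
   Context: A permutation of length $n$ is a word $\pi=\pi_1\pi_2\cdots\pi_n$ in which each of $1,\dots,n$ appears exactly once (for $n=0$ it is the empty word). The classical pattern $1\mbox{-}3\mbox{-}2$ occurs in $\pi$ if there are indices $i<j<l$ with $\pi_i<\pi_l<\pi_j$; $\pi$ avoids $1\mbox{-}3\mbox{-}2$ if there is no such occurrence. A permutation $\pi$ of length $n$ is alternating if $\pi_{2j-1}<\pi_{2j}$ and $\pi_{2j}>\pi_{2j+1}$ whenever these indices lie in $\{1,\dots,n\}$ (so $\pi_1<\pi_2>\pi_3<\pi_4>\cdots$); the permutations of length $0$ and $1$ are alternating. For $n\geq 2$: an up-down permutation is an alternating permutation of odd length (it starts with a rise and ends with a descent); an up-up permutation is an alternating permutation of even length (starts and ends with a rise); a down-up permutation is one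 with $\pi_1>\pi_2<\pi_3>\pi_4<\cdots$ of odd length (starts with a descent, ends with a rise); a down-down permutation is one with $\pi_1>\pi_2<\pi_3>\cdots$ of even length (starts and ends with a descent). For $n=0,1$ there are no up-down, up-up, down-up or down-down permutations. *)

theory Defs
  imports Complex_Main "HOL-Combinatorics.Multiset_Permutations"
begin

text \<open>
  Permutations of length \<open>n\<close> are words, i.e. elements of \<open>permutations_of_set {1..n}\<close>.
  Lists are indexed from 0, so \<open>\<pi> ! i\<close> is the letter at the 1-based position \<open>i + 1\<close>.
\<close>

definition contains_132 :: "nat list \<Rightarrow> bool" where
  "contains_132 \<pi> \<longleftrightarrow>
     (\<exists>i j l. i < j \<and> j < l \<and> l < length \<pi> \<and> \<pi> ! i < \<pi> ! l \<and> \<pi> ! l < \<pi> ! j)"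

definition avoiders_132 :: "nat \<Rightarrow> nat list set" where
  "avoiders_132 n = {\<pi> \<in> permutations_of_set {1..n}. \<not> contains_132 \<pi>}"

definition alternating :: "nat list \<Rightarrow> bool" where
  "alternating \<pi> \<longleftrightarrow>
     (\<forall>j. 2 * j + 1 < length \<pi> \<longrightarrow> \<pi> ! (2 * j) < \<pi> ! (2 * j + 1)) \<and>
     (\<forall>j. 2 * j + 2 < length \<pi> \<longrightarrow> \<pi> ! (2 * j + 1) > \<pi> ! (2 * j + 2))"

definition reverse_alternating :: "nat list \<Rightarrow> bool" where
  "reverse_alternating \<pi> \<longleftrightarrow>
     (\<forall>j. 2 * j + 1 < length \<pi> \<longrightarrow> \<pi> ! (2 * j) > \<pi> ! (2 * j + 1)) \<and>
     (\<forall>j. 2 * j + 2 < length \<pi> \<longrightarrow> \<pi> ! (2 * j + 1) < \<pi> ! (2 * j + 2))"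

definition up_down :: "nat list \<Rightarrow> bool" where
  "up_down \<pi> \<longleftrightarrow> length \<pi> \<ge> 2 \<and> odd (length \<pi>) \<and> alternating \<pi>"

definition up_up :: "nat list \<Rightarrow> bool" where
  "up_up \<pi> \<longleftrightarrow> length \<pi> \<ge> 2 \<and> even (length \<pi>) \<and> alternating \<pi>"

definition down_up :: "nat list \<Rightarrow> bool" where
  "down_up \<pi> \<longleftrightarrow> length \<pi> \<ge> 2 \<and> odd (length \<pi>) \<and> reverse_alternating \<pi>"

definition down_down :: "nat list \<Rightarrow> bool" where
  "down_down \<pi> \<longleftrightarrow> length \<pi> \<ge> 2 \<and> even (length \<pi>) \<and> reverse_alternating \<pi>"

definition catalan :: "nat \<Rightarrow> real" where
  "catalan m = 1 / (real m + 1) * real ((2 * m) choose m)"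

text \<open>Catalan numbers at real arguments, with value 0 off the natural numbers.\<close>

definition catalan_ext :: "real \<Rightarrow> real" where
  "catalan_ext x = (if x \<in> \<nat> then catalan (nat \<lfloor>x\<rfloor>) else 0)"

end

theory Submission
  imports Defs
begin

text \<open>
  A nonempty word on \<open>{1..n}\<close> avoids 1-3-2 iff it is \<open>L n R\<close> with \<open>L\<close> and \<open>R\<close> avoiding 1-3-2
  and every letter of \<open>L\<close> above every letter of \<open>R\<close>. In an alternating word of length at least 2
  the maximum sits on a peak, which fixes the parity of \<open>length L\<close>; moreover \<open>R\<close> then
  starts with a rise and \<open>L\<close> keeps the type of the whole word. So both
  kinds of alternating avoiders are counted by Catalan convolutions in half the length.
\<close>

section \<open>The Catalan recurrence\<close>

lemma catalan_0 [simp]: "catalan 0 = 1"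
  by (simp add: catalan_def)

text \<open>The absorption identity, applied to \<open>2 * n + 2\<close> and to
  \<open>2 * n + 1\<close>, with the symmetry of the two middle binomials of row
  \<open>2 * n + 1\<close> in between, relates consecutive central binomials.\<close>

lemma catalan_Suc: "(real n + 2) * catalan (Suc n) = (4 * real n + 2) * catalan n"
proof -
  define B where "B = real ((2 * n) choose n)"
  have 1: "(n + 1) * (2 * n + 1 choose (n + 1)) = (2 * n + 1) * (2 * n choose n)"
    using Suc_times_binomial[of n "2 * n"] by simp
  have 2: "(n + 1) * (2 * n + 2 choose (n + 1)) = (2 * n + 2) * (2 * n + 1 choose n)"
    using Suc_times_binomial[of n "2 * n + 1"] by simp
  have 3: "(2 * n + 1 choose n) = (2 * n + 1 choose (n + 1))"
    using binomial_symmetric[of n "2 * n + 1"] by simp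
  have "(n + 1) * (2 * n + 2 choose (n + 1)) = 2 * ((2 * n + 1) * (2 * n choose n))"
    using 1 2 3 by (simp add: algebra_simps)
  then have "real ((n + 1) * (2 * n + 2 choose (n + 1))) = real (2 * ((2 * n + 1) * (2 * n choose n)))"
    by (rule arg_cong)
  then have "(real n + 1) * real (2 * n + 2 choose (n + 1)) = 2 * ((2 * real n + 1) * B)"
    unfolding of_nat_mult of_nat_add B_def by simp
  then show ?thesis
    unfolding catalan_def B_def[symmetric]
    by (simp add: field_simps del: binomial_Suc_Suc)
qed

text \<open>
  Weighting the convolution \<open>S n\<close> by \<open>k\<close> gives \<open>T n = n / 2 * S n\<close> by symmetry, and
  the two-term recursion for \<open>catalan\<close> relates \<open>S (n + 1) + T (n + 1)\<close> to \<open>S n\<close> and \<open>T n\<close>.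
\<close>

lemma catalan_convolution: "(\<Sum>k\<le>n. catalan k * catalan (n - k)) = catalan (Suc n)"
proof -
  define S where "S n = (\<Sum>k\<le>n. catalan k * catalan (n - k))" for n
  define T where "T n = (\<Sum>k\<le>n. real k * (catalan k * catalan (n - k)))" for n
  have T: "2 * T n = real n * S n" for n
  proof -
    have "T n = (\<Sum>k\<le>n. real (n - k) * (catalan (n - k) * catalan (n - (n - k))))"
      unfolding T_def by (rule sum.reindex_bij_witness[of _ "\<lambda>k. n - k" "\<lambda>k. n - k"]) auto
    also have "\<dots> = (\<Sum>k\<le>n. (real n - real k) * (catalan k * catalan (n - k)))"
      by (intro sum.cong) (auto simp: of_nat_diff)
    also have "\<dots> = real n * S n - T n"
      by (simp add: S_def T_def left_diff_distrib sum_subtractf sum_distrib_left)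
    finally show ?thesis by simp
  qed
  have step: "T (Suc n) + S (Suc n) = catalan (Suc n) + 4 * T n + 2 * S n" for n
  proof -
    have "T (Suc n) + S (Suc n) = (\<Sum>k\<le>Suc n. (real k + 1) * (catalan k * catalan (Suc n - k)))"
      by (simp only: T_def S_def sum.distrib[symmetric] distrib_right mult_1)
    also have "\<dots> = catalan (Suc n)
        + (\<Sum>k\<le>n. (real k + 2) * catalan (Suc k) * catalan (n - k))"
      by (subst sum.atMost_Suc_shift) (simp add: algebra_simps)
    also have "(\<Sum>k\<le>n. (real k + 2) * catalan (Suc k) * catalan (n - k)) = 4 * T n + 2 * S n"
      unfolding catalan_Suc T_def S_def sum_distrib_left sum.distrib[symmetric]
      by (intro sum.cong) (simp_all add: algebra_simps)
    finally show ?thesis by simp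
  qed
  have "S n = catalan (Suc n)"
  proof (induction n)
    case 0
    show ?case by (simp add: S_def catalan_def)
  next
    case (Suc n)
    \<comment> \<open>Twice \<open>step\<close>, with each \<open>2 * T\<close> replaced through
      \<open>T\<close>, gives the factor \<open>(n + 1) + 2\<close> on the left. With the induction
      hypothesis the right side becomes \<open>(4 * (n + 1) + 2) * catalan (n + 1)\<close>, the form
      of \<open>catalan_Suc\<close>.\<close>
    have "(real n + 3) * S (Suc n) = 2 * catalan (Suc n) + 4 * (real n * S n) + 4 * S n"
      using step[of n] T[of n] T[of "Suc n"] by (simp add: algebra_simps)
    also have "\<dots> = (real n + 3) * catalan (Suc (Suc n))"
      using catalan_Suc[of "Suc n"] Suc.IH by (simp add: algebra_simps)
    finally show ?case by simp
  qed
  then show ?thesis by (simp add: S_def)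
qed

section \<open>Splitting a 1-3-2-avoiding permutation at its maximum\<close>

text \<open>Both arguments are meant to be permutations of initial segments. Lifting
  \<open>L\<close> by \<open>length R\<close> places its letters just above those of
  \<open>R\<close>, so the result is again such a permutation.\<close>

definition max_join :: "nat list \<Rightarrow> nat list \<Rightarrow> nat list" where
  "max_join L R = map ((+) (length R)) L @ Suc (length L + length R) # R"

lemma avoiders_132D:
  assumes "\<pi> \<in> avoiders_132 n"
  shows "set \<pi> = {1..n}" "distinct \<pi>" "length \<pi> = n" "\<not> contains_132 \<pi>"
  using assms distinct_card[of \<pi>]
  by (auto simp: avoiders_132_def permutations_of_set_def)

lemma avoiders_132I:
  "set \<pi> = {1..n} \<Longrightarrow> distinct \<pi> \<Longrightarrow> \<not> contains_132 \<pi> \<Longrightarrow> \<pi> \<in> avoiders_132 n"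
  by (auto simp: avoiders_132_def permutations_of_set_def)

lemma finite_avoiders_132 [simp]: "finite (avoiders_132 n)"
  by (simp add: avoiders_132_def)

lemma avoiders_132_0 [simp]: "avoiders_132 0 = {[]}"
  by (auto simp: avoiders_132_def contains_132_def)

lemma contains_132_shift [simp]: "contains_132 (map ((+) (k :: nat)) L) \<longleftrightarrow> contains_132 L"
  unfolding contains_132_def
  by (intro ex_cong1 conj_cong refl) auto

lemma contains_132_append: "contains_132 A \<or> contains_132 B \<Longrightarrow> contains_132 (A @ B)"
proof (elim disjE)
  assume "contains_132 A"
  then obtain i j l where "i < j" "j < l" "l < length A" "A ! i < A ! l" "A ! l < A ! j"
    unfolding contains_132_def by blast
  then show ?thesis
    unfolding contains_132_def by (intro exI[of _ i] exI[of _ j] exI[of _ l]) (auto simp: nth_append)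
next
  assume "contains_132 B"
  then obtain i j l where "i < j" "j < l" "l < length B" "B ! i < B ! l" "B ! l < B ! j"
    unfolding contains_132_def by blast
  then show ?thesis
    unfolding contains_132_def
    by (intro exI[of _ "length A + i"] exI[of _ "length A + j"] exI[of _ "length A + l"])
      (auto simp: nth_append)
qed

text \<open>The strict maximum \<open>m\<close> can only play the 3. An occurrence therefore lies
  inside \<open>A\<close>, lies inside \<open>R\<close>, or has its 1 in \<open>A\<close> and its 2
  in \<open>R\<close>; conversely, any such ascending pair forms an occurrence with \<open>m\<close>
  as the 3.\<close>

lemma contains_132_split_max:
  assumes A: "\<And>x. x \<in> set A \<Longrightarrow> x < m" and R: "\<And>y. y \<in> set R \<Longrightarrow> y < m"
  shows "contains_132 (A @ m # R) \<longleftrightarrow>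
    contains_132 A \<or> contains_132 R \<or> (\<exists>x\<in>set A. \<exists>y\<in>set R. x < y)"
proof
  assume "contains_132 A \<or> contains_132 R \<or> (\<exists>x\<in>set A. \<exists>y\<in>set R. x < y)"
  then consider "contains_132 A \<or> contains_132 R" | x y where "x \<in> set A" "y \<in> set R" "x < y"
    by blast
  then show "contains_132 (A @ m # R)"
  proof cases
    case 1
    then show ?thesis
      using contains_132_append[of A "m # R"] contains_132_append[of "[m]" R] by auto
  next
    case 2
    then obtain i l where "i < length A" "A ! i = x" "l < length R" "R ! l = y"
      by (auto simp: in_set_conv_nth)
    with 2 R[of y] show ?thesis
      unfolding contains_132_def
      by (intro exI[of _ i] exI[of _ "length A"] exI[of _ "Suc (length A + l)"])
        (auto simp: nth_append)
  qed
next
  assume "contains_132 (A @ m # R)"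
  then obtain i j l where ijl: "i < j" "j < l" "l < Suc (length A + length R)"
    and lt: "(A @ m # R) ! i < (A @ m # R) ! l" "(A @ m # R) ! l < (A @ m # R) ! j"
    unfolding contains_132_def by auto
  have le: "(A @ m # R) ! k \<le> m" if "k < Suc (length A + length R)" for k
    using that A R nth_mem[of k "A @ m # R"] by (auto intro: less_imp_le)
  show "contains_132 A \<or> contains_132 R \<or> (\<exists>x\<in>set A. \<exists>y\<in>set R. x < y)"
  proof (cases "l < length A")
    case True
    then have "contains_132 A"
      using ijl lt unfolding contains_132_def
      by (intro exI[of _ i] exI[of _ j] exI[of _ l]) (auto simp: nth_append)
    then show ?thesis ..
  next
    case False
    \<comment> \<open>The letters at \<open>i\<close> and \<open>l\<close> are both strictly below
      another letter, so neither is \<open>m\<close>.\<close>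
    have "l \<noteq> length A" "i \<noteq> length A"
      using lt le[of j] le[of l] ijl by (auto simp: nth_append)
    with False have l: "length A < l" by simp
    define l' where "l' = l - Suc (length A)"
    have l': "l = length A + Suc l'" "l' < length R" using l ijl by (auto simp: l'_def)
    show ?thesis
    proof (cases "i < length A")
      case True
      then have "A ! i < R ! l'" using lt l' by (simp add: nth_append)
      then show ?thesis using True l' nth_mem by blast
    next
      case False
      with \<open>i \<noteq> length A\<close> have "length A < i" by simp
      then obtain i' j' where "i = length A + Suc i'" "j = length A + Suc j'"
        using ijl by (metis add_Suc_right less_imp_Suc_add less_trans)
      then have "contains_132 R"
        using ijl lt l' unfolding contains_132_def
        by (intro exI[of _ i'] exI[of _ j'] exI[of _ l']) (auto simp: nth_append)
      then show ?thesis by blast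
    qed
  qed
qed

lemma max_join_in_avoiders_132:
  assumes "L \<in> avoiders_132 p" "R \<in> avoiders_132 r"
  shows "max_join L R \<in> avoiders_132 (Suc (p + r))"
proof (rule avoiders_132I)
  note L = avoiders_132D[OF assms(1)] and R = avoiders_132D[OF assms(2)]
  have sL: "set (map ((+) r) L) = {r + 1..r + p}"
    using L by simp
  show "set (max_join L R) = {1..Suc (p + r)}"
    unfolding max_join_def set_append list.set(2) using sL L R by auto
  show "distinct (max_join L R)"
    using L R by (auto simp: max_join_def distinct_map)
  show "\<not> contains_132 (max_join L R)"
    unfolding max_join_def
    using L R by (subst contains_132_split_max) auto
qed

text \<open>Avoidance forces every letter before the maximum above every letter after it. The
  letters after it are then exactly \<open>{1..r}\<close>, and lowering the others by
  \<open>r\<close> recovers \<open>L\<close>.\<close>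

lemma avoiders_132_SucE:
  assumes "\<pi> \<in> avoiders_132 (Suc n)"
  obtains p L R where "p \<le> n" "L \<in> avoiders_132 p" "R \<in> avoiders_132 (n - p)" "\<pi> = max_join L R"
proof -
  note \<pi> = avoiders_132D[OF assms]
  from \<pi> have "Suc n \<in> set \<pi>" by simp
  then obtain A R where split: "\<pi> = A @ Suc n # R"
    by (auto simp: in_set_conv_decomp)
  define p r where "p = length A" and "r = length R"
  have n: "n = p + r" using \<pi>(3) by (simp add: split p_def r_def)
  have dist: "distinct A" "distinct R" "set A \<inter> set R = {}" "Suc n \<notin> set A" "Suc n \<notin> set R"
    using \<pi>(2) by (auto simp: split)
  have "set A \<union> set R = set \<pi> - {Suc n}"
    unfolding split using dist(4,5) by auto
  also have "\<dots> = {1..n}"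
    unfolding \<pi>(1) by auto
  finally have AR: "set A \<union> set R = {1..n}" .
  have lt: "x < Suc n" if "x \<in> set A \<union> set R" for x
    using that AR by auto
  have av: "\<not> contains_132 A" "\<not> contains_132 R" and "\<And>x y. x \<in> set A \<Longrightarrow> y \<in> set R \<Longrightarrow> \<not> x < y"
    using \<pi>(4) lt by (auto simp: split contains_132_split_max)
  then have gt: "y < x" if "x \<in> set A" "y \<in> set R" for x y
    using that dist(3) by (metis disjoint_iff linorder_neqE_nat)
  have cR: "card (set R) = r"
    using dist by (simp add: distinct_card r_def)
  have setR: "set R = {1..r}"
  proof (rule card_subset_eq)
    show "set R \<subseteq> {1..r}"
    proof
      fix y assume y: "y \<in> set R"
      then have "y \<le> n" using lt[of y] by simp
      \<comment> \<open>Letters of \<open>A\<close> exceed \<open>y\<close>, so all values up to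
        \<open>y\<close> lie in \<open>R\<close>; counting them bounds \<open>y\<close> by
        \<open>r\<close>.\<close>
      have "{1..y} \<subseteq> set R"
      proof
        fix z assume z: "z \<in> {1..y}"
        then have "z \<in> set A \<union> set R" using \<open>y \<le> n\<close> unfolding AR by auto
        then show "z \<in> set R" using gt[of z y] y z by auto
      qed
      then have "y \<le> r"
        using card_mono[of "set R" "{1..y}"] cR by simp
      then show "y \<in> {1..r}" using y AR by auto
    qed
  qed (use cR in auto)
  have "set A = {1..n} - {1..r}"
    using AR dist(3) setR by blast
  also have "\<dots> = {r + 1..n}"
    by auto
  finally have setA: "set A = {r + 1..n}" .
  define L where "L = map (\<lambda>x. x - r) A"
  have A: "A = map ((+) r) L"
    unfolding L_def map_map using setA by (intro map_idI[symmetric]) auto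
  have "set L = {1..p}"
  proof -
    have "(+) r ` set L = (+) r ` {1..p}"
      using setA n by (simp add: A add.commute)
    then show ?thesis by (subst (asm) inj_image_eq_iff) auto
  qed
  then have "L \<in> avoiders_132 p"
    using dist(1) av(1) by (intro avoiders_132I) (auto simp: A distinct_map)
  moreover have "R \<in> avoiders_132 (n - p)"
    using setR dist(2) av(2) n by (intro avoiders_132I) auto
  moreover have "\<pi> = max_join L R"
    by (simp add: max_join_def split n A flip: r_def) (simp add: L_def p_def)
  moreover have "p \<le> n" using n by simp
  ultimately show thesis using that by blast
qed

lemma bij_betw_max_join:
  "bij_betw (\<lambda>(L, R). max_join L R)
    (\<Union>p\<le>n. avoiders_132 p \<times> avoiders_132 (n - p)) (avoiders_132 (Suc n))"
  unfolding bij_betw_def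
proof
  show "inj_on (\<lambda>(L, R). max_join L R) (\<Union>p\<le>n. avoiders_132 p \<times> avoiders_132 (n - p))"
  proof (rule inj_onI, clarsimp)
    fix p q L R L' R'
    assume "p \<le> n" "q \<le> n"
      and mem: "L \<in> avoiders_132 p" "R \<in> avoiders_132 (n - p)" "L' \<in> avoiders_132 q" "R' \<in> avoiders_132 (n - q)"
      and eq: "max_join L R = max_join L' R'"
    note D = mem[THEN avoiders_132D(1)] mem[THEN avoiders_132D(3)]
    have len: "length L + length R = n" "length L' + length R' = n"
      using D \<open>p \<le> n\<close> \<open>q \<le> n\<close> by auto
    \<comment> \<open>The maximum occurs only once in each word, so both words split around it in
      the same way. Then \<open>R = R'\<close> makes the two shifts equal, and the shift is
      injective.\<close>
    have "Suc n \<notin> set (map ((+) (length R)) L)" "Suc n \<notin> set R"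
      "Suc n \<notin> set (map ((+) (length R')) L')" "Suc n \<notin> set R'"
      using D \<open>p \<le> n\<close> \<open>q \<le> n\<close> by auto
    with eq have *: "map ((+) (length R)) L = map ((+) (length R')) L'" "R = R'"
      unfolding max_join_def len by (auto simp: append_Cons_eq_iff)
    then show "L = L' \<and> R = R'"
      by (auto simp: inj_map_eq_map)
  qed
  show "(\<lambda>(L, R). max_join L R) ` (\<Union>p\<le>n. avoiders_132 p \<times> avoiders_132 (n - p)) = avoiders_132 (Suc n)"
  proof safe
    fix p L R assume "p \<le> n" "L \<in> avoiders_132 p" "R \<in> avoiders_132 (n - p)"
    then show "max_join L R \<in> avoiders_132 (Suc n)"
      using max_join_in_avoiders_132[of L p R "n - p"] by simp
  next
    fix \<pi> assume "\<pi> \<in> avoiders_132 (Suc n)"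
    then obtain p L R where
      "p \<le> n" "L \<in> avoiders_132 p" "R \<in> avoiders_132 (n - p)" "\<pi> = max_join L R"
      by (rule avoiders_132_SucE)
    then show "\<pi> \<in> (\<lambda>(L, R). max_join L R) ` (\<Union>p\<le>n. avoiders_132 p \<times> avoiders_132 (n - p))"
      by (intro image_eqI[of _ _ "(L, R)"]) auto
  qed
qed

lemma card_avoiders_132_Suc_filter:
  "card {\<pi> \<in> avoiders_132 (Suc n). P \<pi>} =
    (\<Sum>p\<le>n. card {(L, R) \<in> avoiders_132 p \<times> avoiders_132 (n - p). P (max_join L R)})"
proof -
  let ?D = "\<lambda>p. {(L, R) \<in> avoiders_132 p \<times> avoiders_132 (n - p). P (max_join L R)}"
  note B = bij_betw_max_join[of n, unfolded bij_betw_def]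
  have fin: "finite (?D p)" for p
    by (rule finite_subset[of _ "avoiders_132 p \<times> avoiders_132 (n - p)"]) auto
  have "{\<pi> \<in> avoiders_132 (Suc n). P \<pi>} = (\<lambda>(L, R). max_join L R) ` (\<Union>p\<le>n. ?D p)"
    unfolding conjunct2[OF B, symmetric] by force
  moreover have "inj_on (\<lambda>(L, R). max_join L R) (\<Union>p\<le>n. ?D p)"
    by (rule inj_on_subset[OF conjunct1[OF B]]) auto
  ultimately have "card {\<pi> \<in> avoiders_132 (Suc n). P \<pi>} = card (\<Union>p\<le>n. ?D p)"
    by (simp add: card_image)
  also have "\<dots> = (\<Sum>p\<le>n. card (?D p))"
    \<comment> \<open>The sets for different \<open>p\<close> are disjoint because \<open>p\<close>
      is the length of \<open>L\<close>.\<close>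
    by (rule card_UN_disjoint) (use fin in \<open>auto dest!: avoiders_132D(3)\<close>)
  finally show ?thesis .
qed

section \<open>Alternating words\<close>

text \<open>The flag tells whether the first step is a rise. Carrying it through the recursion
  treats both kinds of alternation at once, which the counting needs because they occur together in
  one recurrence.\<close>

fun zigzag :: "bool \<Rightarrow> nat list \<Rightarrow> bool" where
  "zigzag b (x # y # ys) \<longleftrightarrow> (if b then x < y else x > y) \<and> zigzag (\<not> b) (y # ys)"
| "zigzag b _ \<longleftrightarrow> True"

lemma zigzag_iff_nth:
  "zigzag b xs \<longleftrightarrow>
    (\<forall>i. Suc i < length xs \<longrightarrow> (if even i = b then xs ! i < xs ! Suc i else xs ! i > xs ! Suc i))"
proof (induction b xs rule: zigzag.induct)
  case (1 b x y ys)
  \<comment> \<open>Index 0 accounts for the comparison of the first two letters; shifting the other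
    indices by one flips their parity, as the tail's flag does.\<close>
  have split_0: "(\<forall>i. P i) \<longleftrightarrow> P 0 \<and> (\<forall>i. P (Suc i))" for P :: "nat \<Rightarrow> bool"
    by (metis not0_implies_Suc)
  show ?case
    unfolding zigzag.simps 1 by (subst (2) split_0) auto
qed auto

lemma alternating_iff_zigzag: "alternating xs \<longleftrightarrow> zigzag True xs"
  unfolding alternating_def zigzag_iff_nth
  by (auto elim!: evenE oddE)

lemma reverse_alternating_iff_zigzag: "reverse_alternating xs \<longleftrightarrow> zigzag False xs"
  unfolding reverse_alternating_def zigzag_iff_nth
  by (auto elim!: evenE oddE)

text \<open>The maximum is entered by a rise and left by a descent. Step \<open>i\<close> is a rise
  iff \<open>even i = b\<close>, so either neighbour of \<open>m\<close>, if present, forces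
  \<open>b = odd (length L)\<close>. After the descent from \<open>m\<close> the next step is a
  rise, whence \<open>zigzag True R\<close>.\<close>

lemma zigzag_split_max:
  assumes "\<And>x. x \<in> set L \<Longrightarrow> x < m" "\<And>x. x \<in> set R \<Longrightarrow> x < m"
  shows "zigzag b (L @ m # R) \<longleftrightarrow>
    zigzag b L \<and> zigzag True R \<and> (L = [] \<and> R = [] \<or> b = odd (length L))"
  using assms
proof (induction b L rule: zigzag.induct)
  case (1 b x y ys)
  then show ?case by auto
next
  case ("2_1" b)
  then show ?case by (cases R) force+
next
  case ("2_2" b x)
  then show ?case by (cases R) force+
qed

lemma zigzag_shift [simp]: "zigzag b (map ((+) k) xs) \<longleftrightarrow> zigzag b xs"
  by (induction b xs rule: zigzag.induct) auto

lemma zigzag_max_join: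
  assumes "L \<in> avoiders_132 p" "R \<in> avoiders_132 r"
  shows "zigzag b (max_join L R) \<longleftrightarrow>
    zigzag b L \<and> zigzag True R \<and> (p + r = 0 \<or> b = odd p)"
  using avoiders_132D[OF assms(1)] avoiders_132D[OF assms(2)]
  unfolding max_join_def by (subst zigzag_split_max) auto

section \<open>Counting alternating avoiders\<close>

text \<open>For a fixed position \<open>p\<close> of the maximum the conditions on \<open>L\<close>
  and \<open>R\<close> are independent, which gives a product. The alternative \<open>n = 0\<close>
  is the one-letter word, where no parity is imposed.\<close>

lemma card_zigzag_Suc:
  "card {\<pi> \<in> avoiders_132 (Suc n). zigzag b \<pi>} =
    (\<Sum>p | p \<le> n \<and> (n = 0 \<or> b = odd p).
      card {\<pi> \<in> avoiders_132 p. zigzag b \<pi>} * card {\<pi> \<in> avoiders_132 (n - p). zigzag True \<pi>})"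
proof -
  have "card {(L, R) \<in> avoiders_132 p \<times> avoiders_132 (n - p). zigzag b (max_join L R)} =
    (if n = 0 \<or> b = odd p
     then card {\<pi> \<in> avoiders_132 p. zigzag b \<pi>} * card {\<pi> \<in> avoiders_132 (n - p). zigzag True \<pi>}
     else 0)" if "p \<le> n" for p
  proof -
    have "{(L, R) \<in> avoiders_132 p \<times> avoiders_132 (n - p). zigzag b (max_join L R)} =
      (if n = 0 \<or> b = odd p
       then {\<pi> \<in> avoiders_132 p. zigzag b \<pi>} \<times> {\<pi> \<in> avoiders_132 (n - p). zigzag True \<pi>}
       else {})"
      using that by (auto simp: zigzag_max_join[of _ p _ "n - p"])
    then show ?thesis by (simp add: card_cartesian_product)
  qed
  then show ?thesis
    unfolding card_avoiders_132_Suc_filter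
    by (subst sum.inter_filter[of "{..n}", simplified]) auto
qed

text \<open>Strong induction for both flags together, since the recurrence for \<open>False\<close>
  also involves the count for \<open>True\<close>. Only one parity of \<open>p\<close> contributes,
  and halving the lengths turns the sum into the Catalan convolution.\<close>

lemma card_zigzag_avoiders_132:
  "real (card {\<pi> \<in> avoiders_132 n. zigzag b \<pi>}) = catalan ((if b then n else Suc n) div 2)"
proof (induction n arbitrary: b rule: less_induct)
  case (less n)
  \<comment> \<open>A one-letter word with flag \<open>True\<close> is set apart: its maximum is at
    position 0, although the parity rule would ask for an odd position.\<close>
  consider "n = 0" | "n = 1" "b" | m where "n = Suc m" "b \<longrightarrow> m \<noteq> 0"
    by (cases n) auto
  then show ?case
  proof cases
    case 1
    have "{\<pi> \<in> avoiders_132 0. zigzag b \<pi>} = {[]}" by auto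
    with 1 show ?thesis by simp
  next
    case 2
    have "{\<pi> \<in> avoiders_132 0. zigzag b \<pi>} = {[]}" for b by auto
    moreover have "{p. p \<le> 0 \<and> True} = {0 :: nat}" by auto
    ultimately show ?thesis
      using 2 card_zigzag_Suc[of 0 b] by simp
  next
    case 3
    \<comment> \<open>The admissible lengths of \<open>L\<close> are \<open>2 * k + c\<close>:
      \<open>c\<close> is the least of them, and \<open>q\<close> is the largest \<open>k\<close>
      with \<open>2 * k + c \<le> m\<close>.\<close>
    define c where "c = (if b then 1 else 0 :: nat)"
    define q where "q = (m - c) div 2"
    have c: "c \<le> m" "c \<le> 1" "even c = (\<not> b)" using 3 by (auto simp: c_def)
    have idx: "{p. p \<le> m \<and> (m = 0 \<or> b = odd p)} = (\<lambda>k. 2 * k + c) ` {..q}"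
    proof (intro equalityI subsetI)
      fix p assume "p \<in> {p. p \<le> m \<and> (m = 0 \<or> b = odd p)}"
      then have p: "p \<le> m" "b = odd p" using 3 by auto
      then have "p = 2 * (p div 2) + c" "p div 2 \<le> q"
        unfolding c_def q_def by (auto elim!: evenE oddE)
      then show "p \<in> (\<lambda>k. 2 * k + c) ` {..q}" by blast
    next
      fix p assume "p \<in> (\<lambda>k. 2 * k + c) ` {..q}"
      then obtain k where "p = 2 * k + c" "k \<le> q" by blast
      then show "p \<in> {p. p \<le> m \<and> (m = 0 \<or> b = odd p)}"
        using c unfolding q_def by auto
    qed
    have "real (card {\<pi> \<in> avoiders_132 n. zigzag b \<pi>}) =
      (\<Sum>p | p \<le> m \<and> (m = 0 \<or> b = odd p).
        catalan ((if b then p else Suc p) div 2) * catalan ((m - p) div 2))"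
      unfolding 3(1) card_zigzag_Suc of_nat_sum of_nat_mult
      using less.IH 3(1) by (intro sum.cong) auto
    also have "\<dots> = (\<Sum>k\<le>q. catalan k * catalan (q - k))"
      unfolding idx
    proof (subst sum.reindex)
      show "inj_on (\<lambda>k. 2 * k + c) {..q}" by (auto simp: inj_on_def)
      \<comment> \<open>For either flag the halved argument is \<open>(2 * k + 1) div 2\<close>, so
        the factor of \<open>L\<close> is \<open>catalan k\<close>.\<close>
      have "(if b then 2 * k + c else Suc (2 * k + c)) div 2 = k" for k
        by (simp add: c_def)
      moreover have "(m - (2 * k + c)) div 2 = q - k" for k
        unfolding q_def by arith
      ultimately show "sum ((\<lambda>p. catalan ((if b then p else Suc p) div 2) * catalan ((m - p) div 2)) \<circ>
          (\<lambda>k. 2 * k + c)) {..q} = (\<Sum>k\<le>q. catalan k * catalan (q - k))"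
        by simp
    qed
    also have "\<dots> = catalan (Suc q)" by (rule catalan_convolution)
    also have "Suc q = (if b then n else Suc n) div 2"
      using 3 by (auto simp: q_def c_def)
    finally show ?thesis .
  qed
qed

section \<open>Half-integer Catalan arguments and the final counts\<close>

text \<open>All arguments of \<open>catalan_ext\<close> in the theorem are halves of naturals. The
  value 0 at odd \<open>k\<close> matches the emptiness of a class whose parity of length is
  wrong.\<close>

lemma catalan_ext_half:
  "catalan_ext (real k / 2) = (if even k then catalan (k div 2) else 0)"
proof (cases "even k")
  case True
  then show ?thesis by (auto elim!: evenE simp: catalan_ext_def)
next
  case False
  have "real k / 2 \<notin> \<nat>"
  proof
    assume "real k / 2 \<in> \<nat>"
    then obtain j where "real k / 2 = real j" by (auto elim: Nats_cases)
    then have "real k = real (2 * j)" by simp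
    then have "k = 2 * j" by (simp only: of_nat_eq_iff)
    with False show False by simp
  qed
  with False show ?thesis by (simp add: catalan_ext_def)
qed

theorem theorem2p2:
  shows "(\<forall>n. real (card {\<pi> \<in> avoiders_132 n. alternating \<pi>}) = catalan (n div 2)) \<and>
    (\<forall>n\<ge>3.
      real (card {\<pi> \<in> avoiders_132 n. up_down \<pi>}) = catalan_ext ((real n - 1) / 2) \<and>
      real (card {\<pi> \<in> avoiders_132 n. up_up \<pi>}) = catalan_ext (real n / 2) \<and>
      real (card {\<pi> \<in> avoiders_132 n. down_up \<pi>}) = catalan_ext ((real n + 1) / 2) \<and>
      real (card {\<pi> \<in> avoiders_132 n. down_down \<pi>}) = catalan_ext (real n / 2))"
proof (intro conjI allI impI)
  show alt: "real (card {\<pi> \<in> avoiders_132 n. alternating \<pi>}) = catalan (n div 2)" for n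
    using card_zigzag_avoiders_132[of n True] by (simp add: alternating_iff_zigzag)
  have ralt: "real (card {\<pi> \<in> avoiders_132 n. reverse_alternating \<pi>}) = catalan (Suc n div 2)" for n
    using card_zigzag_avoiders_132[of n False] by (simp add: reverse_alternating_iff_zigzag)
  fix n :: nat
  assume n: "3 \<le> n"
  \<comment> \<open>All words considered have length \<open>n \<ge> 3\<close>, so the length
    conditions either hold for all of them or exclude all of them.\<close>
  have restrict: "{\<pi> \<in> avoiders_132 n. 2 \<le> length \<pi> \<and> Q (length \<pi>) \<and> P \<pi>} =
    (if Q n then {\<pi> \<in> avoiders_132 n. P \<pi>} else {})" for Q P
    using n by (auto dest: avoiders_132D(3))
  have m1: "(real n - 1) / 2 = real (n - 1) / 2" and p1: "(real n + 1) / 2 = real (Suc n) / 2"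
    using n by (auto simp: of_nat_diff)
  show "real (card {\<pi> \<in> avoiders_132 n. up_down \<pi>}) = catalan_ext ((real n - 1) / 2)"
    unfolding up_down_def restrict[of odd] m1 catalan_ext_half
    \<comment> \<open>For odd \<open>n\<close> the indices \<open>(n - 1) div 2\<close> and
      \<open>n div 2\<close> agree.\<close>
    using n by (auto simp: alt elim!: oddE)
  show "real (card {\<pi> \<in> avoiders_132 n. up_up \<pi>}) = catalan_ext (real n / 2)"
    unfolding up_up_def restrict[of even] catalan_ext_half by (simp add: alt)
  show "real (card {\<pi> \<in> avoiders_132 n. down_up \<pi>}) = catalan_ext ((real n + 1) / 2)"
    unfolding down_up_def restrict[of odd] p1 catalan_ext_half by (simp add: ralt)
  show "real (card {\<pi> \<in> avoiders_132 n. down_down \<pi>}) = catalan_ext (real n / 2)"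
    \<comment> \<open>For even \<open>n\<close> the index \<open>Suc n div 2\<close> from
      \<open>ralt\<close> equals \<open>n div 2\<close>.\<close>
    unfolding down_down_def restrict[of even] catalan_ext_half by (auto simp: ralt elim!: evenE)
qed

end
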